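(* Let $d\ge 3$ be odd, let $k$ be even and let $V=(\mathbb{C}^k)^{\otimes d}$. For an integer $n\ge 0$ write $W_n=\mathrm{HWV}_{(k\times n)^d}\bigwedge V$, where $(k\times n)^d$ is the $d$-tuple all of whose entries are $k\times n=(n,\ldots,n)$ ($k$ entries). Suppose that the following property $\mathrm{HLP}_{\varnothing,k}$ holds: for each integer $n\in[0,k^{d-1}/2]$ the map $$L^{k^{d-1}-2n}:\ W_n\longrightarrow W_{k^{d-1}-n},\qquad L(v)=\omega\wedge v,$$ is an isomorphism. Then $\mathrm{AT}_d(k)\neq 0$.
   Context: The group $\mathrm{GL}(k)^{\times d}$ acts on $V=(\mathbb{C}^k)^{\otimes d}$ multilinearly and hence on $\bigwedge V$. A vector $v\in\bigwedge V$ is a weight vector of weight $\pmb{\mu}=(\mu^{(1)},\ldots,\mu^{(d)})$, $\mu^{(j)}\in\mathbb{Z}^k$, if every tuple of diagonal matrices $(\mathrm{diag}(a^{(1)}_1,\ldots,a^{(1)}_k),\ldots,\mathrm{diag}(a^{(d)}_1,\ldots,a^{(d)}_k))$ acts on $v$ as the scalar $\prod_j\prod_i (a^{(j)}_i)^{\mu^{(j)}_i}$. $\mathrm{HWV}_{\pmb{\mu}}\bigwedge V$ is the space consisting of $0$ and the nonzero weight vectors of weight $\pmb{\mu}$ invariant under $U(k)^{\times d}$, with $U(k)$ the group of upper unitriangular matrices. The Cayley form is $$\omega=\omega_{d,k}=\sum_{\pi_1,\ldots,\pi_d\in S_k}\mathrm{sgn}(\pi_1\cdots\pi_d)\bigwedge_{i=1}^k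 \left(e_{\pi_1(i)}\otimes\cdots\otimes e_{\pi_d(i)}\right)\in\bigwedge^k V,$$ where $e_1,\ldots,e_k$ is the standard basis of $\mathbb{C}^k$. Alon--Tarsi numbers: for $\ell\in[d]=\{1,\ldots,d\}$ and $i\in[k]$, the $i$-th slice of the cube $[k]^d$ in direction $\ell$ is the set of elements of $[k]^d$ whose $\ell$-th coordinate equals $i$. A $d$-dimensional Latin hypercube is a map $C:[k]^d\to[k^{d-1}]$ that is bijective when restricted to each slice. For a slice $S$, the $S$-permutation of $C$ is the permutation of $[k^{d-1}]$ formed by the values of $C$ on $S$ read in lexicographic order, and $\mathrm{sgn}(C)$ is the product of the signs of the $S$-permutations over all $dk$ slices $S$. Then $\mathrm{AT}_d(k)=\sum_C\mathrm{sgn}(C)$, the sum over all $d$-dimensional Latin hypercubes $C:[k]^d\to[k^{d-1}]$. *)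

theory Defs
  imports
    "Jordan_Normal_Form.Matrix"
    "HOL-Combinatorics.Permutations"
    "HOL-Library.FuncSet"
    "HOL-Library.List_Lexorder"
    Complex_Main
begin

text \<open>
  Indices are zero-based throughout: \<open>[k]\<close> is \<open>{..<k}\<close>, and an element of \<open>[k]\<^sup>d\<close> is a list of
  length \<open>d\<close>.  The order on lists is the lexicographic one, so that
  \<open>sorted_list_of_set\<close> reads a set of such lists lexicographically.
\<close>

definition cube :: "nat \<Rightarrow> nat \<Rightarrow> nat list set" where
  "cube d k = {I. length I = d \<and> set I \<subseteq> {..<k}}"


section \<open>The exterior algebra of a space with an ordered basis\<close>

text \<open>
  Let \<open>V\<close> have the finite ordered basis \<open>B\<close>.  An element \<open>v\<close> of the exterior algebra of \<open>V\<close> is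
  represented by its coordinates: \<open>v S\<close> is the coefficient of \<open>e\<^sub>S\<close>, the wedge product of the
  members of \<open>S \<subseteq> B\<close> in increasing order.  We have \<open>e\<^sub>T \<and> e\<^sub>U = 0\<close> if \<open>T\<close> and \<open>U\<close> meet, and otherwise
  \<open>e\<^sub>T \<and> e\<^sub>U\<close> is \<open>e\<close> at \<open>T \<union> U\<close> times the sign of the permutation sorting the concatenation.
\<close>

type_synonym 'b ext = "'b set \<Rightarrow> complex"

definition ext_space :: "'b set \<Rightarrow> 'b ext set" where
  "ext_space B = {v. \<forall>S. v S \<noteq> 0 \<longrightarrow> S \<subseteq> B}"

definition shuffle_sign :: "'b::linorder set \<Rightarrow> 'b set \<Rightarrow> complex" where
  "shuffle_sign T U = (-1) ^ card {(t, u). t \<in> T \<and> u \<in> U \<and> u < t}"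

definition wedge :: "'b::linorder ext \<Rightarrow> 'b ext \<Rightarrow> 'b ext" where
  "wedge v w = (\<lambda>S. \<Sum>T\<in>Pow S. shuffle_sign T (S - T) * v T * w (S - T))"

definition ext_one :: "'b ext" where
  "ext_one = (\<lambda>S. if S = {} then 1 else 0)"

definition wedge_list :: "'b::linorder ext list \<Rightarrow> 'b ext" where
  "wedge_list vs = foldr wedge vs ext_one"

text \<open>The inclusion of \<open>V\<close>, given in coordinates with respect to \<open>B\<close>, as the part of degree one.\<close>

definition ext_incl :: "('b \<Rightarrow> complex) \<Rightarrow> 'b ext" where
  "ext_incl x = (\<lambda>S. if is_singleton S then x (the_elem S) else 0)"

text \<open>
  The following facts confirm that this is the exterior algebra: the product is bilinear,
  associative and unital, vectors of \<open>V\<close> square to zero, and the ordered products of basis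
  vectors form the standard basis.
\<close>

lemma wedge_linear_right:
  "wedge u (\<lambda>S. a * v S + b * w S) = (\<lambda>S. a * wedge u v S + b * wedge u w S)"
  unfolding wedge_def
  by (simp add: sum.distrib sum_distrib_left algebra_simps)

lemma wedge_linear_left:
  "wedge (\<lambda>S. a * v S + b * w S) u = (\<lambda>S. a * wedge v u S + b * wedge w u S)"
  unfolding wedge_def
  by (simp add: sum.distrib sum_distrib_left algebra_simps)

lemma finite_inversions:
  assumes "finite T" "finite U"
  shows "finite {(t, u). t \<in> T \<and> u \<in> U \<and> P t u}"
  by (rule finite_subset[of _ "T \<times> U"]) (use assms in auto)

lemma shuffle_sign_Un_left:
  assumes "finite A" "finite B" "finite C" "A \<inter> B = {}"
  shows "shuffle_sign (A \<union> B) C = shuffle_sign A C * shuffle_sign B C"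
proof -
  have "{(t, u). t \<in> A \<union> B \<and> u \<in> C \<and> u < t} =
      {(t, u). t \<in> A \<and> u \<in> C \<and> u < t} \<union> {(t, u). t \<in> B \<and> u \<in> C \<and> u < t}"
    by auto
  moreover have "card \<dots> = card {(t, u). t \<in> A \<and> u \<in> C \<and> u < t} + card {(t, u). t \<in> B \<and> u \<in> C \<and> u < t}"
    by (rule card_Un_disjoint) (use assms finite_inversions in auto)
  ultimately show ?thesis
    by (simp add: shuffle_sign_def power_add)
qed

lemma shuffle_sign_Un_right:
  assumes "finite A" "finite B" "finite C" "B \<inter> C = {}"
  shows "shuffle_sign A (B \<union> C) = shuffle_sign A B * shuffle_sign A C"
proof -
  have "{(t, u). t \<in> A \<and> u \<in> B \<union> C \<and> u < t} =
      {(t, u). t \<in> A \<and> u \<in> B \<and> u < t} \<union> {(t, u). t \<in> A \<and> u \<in> C \<and> u < t}"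
    by auto
  moreover have "card \<dots> = card {(t, u). t \<in> A \<and> u \<in> B \<and> u < t} + card {(t, u). t \<in> A \<and> u \<in> C \<and> u < t}"
    by (rule card_Un_disjoint) (use assms finite_inversions in auto)
  ultimately show ?thesis
    by (simp add: shuffle_sign_def power_add)
qed

lemma wedge_infinite: "infinite S \<Longrightarrow> wedge v w S = 0"
  by (simp add: wedge_def)

theorem wedge_assoc: "wedge (wedge u v) w = wedge u (wedge v w)"
proof
  fix S :: "'a set"
  show "wedge (wedge u v) w S = wedge u (wedge v w) S"
  proof (cases "finite S")
    case True
    have fin: "finite T" if "T \<subseteq> S" for T
      using True that finite_subset by blast
    have "wedge (wedge u v) w S =
        (\<Sum>(T, R)\<in>Sigma (Pow S) Pow.
          shuffle_sign T (S - T) * shuffle_sign R (T - R) * u R * v (T - R) * w (S - T))"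
      using True fin
      by (subst sum.Sigma[symmetric])
        (auto simp: wedge_def sum_distrib_left sum_distrib_right mult_ac intro!: sum.cong)
    also have "\<dots> = (\<Sum>(A, B)\<in>Sigma (Pow S) (\<lambda>A. Pow (S - A)).
        shuffle_sign A (S - A) * shuffle_sign B (S - A - B) * u A * v B * w (S - A - B))"
    proof (rule sum.reindex_bij_witness[where
          i = "\<lambda>(A, B). (A \<union> B, A)" and j = "\<lambda>(T, R). (R, T - R)"], goal_cases)
      case (5 p)
      obtain T R where p: "p = (T, R)" "R \<subseteq> T" "T \<subseteq> S"
        using 5 by auto
      have f: "finite R" "finite (T - R)" "finite (S - T)"
        using True p by (auto intro: finite_subset)
      have "shuffle_sign T (S - T) = shuffle_sign R (S - T) * shuffle_sign (T - R) (S - T)"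
        using shuffle_sign_Un_left[of R "T - R" "S - T"] f p by (simp add: Un_absorb1)
      moreover have "S - R = (T - R) \<union> (S - T)"
        using p by auto
      hence "shuffle_sign R (S - R) = shuffle_sign R (T - R) * shuffle_sign R (S - T)"
        using shuffle_sign_Un_right[of R "T - R" "S - T"] f by auto
      moreover have "S - R - (T - R) = S - T"
        using p by auto
      ultimately show ?case
        using p by simp
    qed auto
    also have "\<dots> = wedge u (wedge v w) S"
      using True fin
      by (subst sum.Sigma[symmetric])
        (auto simp: wedge_def sum_distrib_left sum_distrib_right mult_ac intro!: sum.cong)
    finally show ?thesis .
  qed (simp add: wedge_infinite)
qed

lemma shuffle_sign_empty_right: "shuffle_sign T {} = 1"
  by (simp add: shuffle_sign_def)

lemma wedge_one_left:
  assumes "finite S"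
  shows "wedge ext_one v S = v S"
proof -
  have "wedge ext_one v S = (\<Sum>T\<in>Pow S. if T = {} then v S else 0)"
    unfolding wedge_def by (rule sum.cong) (auto simp: ext_one_def shuffle_sign_def)
  thus ?thesis
    using assms by simp
qed

lemma wedge_one_right:
  assumes "finite S"
  shows "wedge v ext_one S = v S"
proof -
  have "wedge v ext_one S = (\<Sum>T\<in>Pow S. if T = S then v S else 0)"
    unfolding wedge_def by (rule sum.cong) (auto simp: ext_one_def shuffle_sign_empty_right)
  thus ?thesis
    using assms by simp
qed

theorem wedge_incl_self: "wedge (ext_incl x) (ext_incl x) = (\<lambda>S. 0)"
proof
  fix S :: "'a set"
  let ?f = "\<lambda>T. shuffle_sign T (S - T) * ext_incl x T * ext_incl x (S - T)"
  show "wedge (ext_incl x) (ext_incl x) S = 0"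
  proof (cases "\<exists>a b. a < b \<and> S = {a, b}")
    case True
    then obtain a b where ab: "a < b" "S = {a, b}"
      by auto
    have P: "Pow S = {{}, {a}, {b}, {a, b}}"
      using ab by auto
    have D: "S - {a} = {b}" "S - {b} = {a}"
      using ab by auto
    have "{(t, u). t \<in> {a} \<and> u \<in> {b} \<and> u < t} = {}" "{(t, u). t \<in> {b} \<and> u \<in> {a} \<and> u < t} = {(b, a)}"
      using ab by auto
    hence s: "shuffle_sign {a} {b} = 1" "shuffle_sign {b} {a} = -1"
      by (simp_all only: shuffle_sign_def) simp_all
    have z: "?f {} = 0" "?f {a, b} = 0"
      using ab by (auto simp: ext_incl_def is_singleton_def)
    have "wedge (ext_incl x) (ext_incl x) S = ?f {} + (?f {a} + (?f {b} + ?f {a, b}))"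
      unfolding wedge_def P using ab by (subst sum.insert; auto)+
    also have "\<dots> = ?f {a} + ?f {b}"
      unfolding z by simp
    also have "\<dots> = 0"
      by (simp add: D s ext_incl_def is_singleton_def)
    finally show ?thesis .
  next
    case False
    have "?f T = 0" if "T \<in> Pow S" for T
    proof (rule ccontr)
      assume "?f T \<noteq> 0"
      hence "is_singleton T" "is_singleton (S - T)"
        by (auto simp: ext_incl_def split: if_splits)
      then obtain a b where ab: "T = {a}" "S - T = {b}"
        by (auto simp: is_singleton_def)
      hence "S = {a, b}" "S = {b, a}" "a \<noteq> b"
        using that by auto
      thus False
        using False by (metis linorder_neq_iff)
    qed
    thus ?thesis
      unfolding wedge_def by (simp add: sum.neutral)
  qed
qed

theorem wedge_list_basis:
  assumes "finite S"
  shows "wedge_list (map (\<lambda>b. ext_incl (\<lambda>c. if c = b then 1 else 0)) (sorted_list_of_set S)) =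
    (\<lambda>T. if T = S then 1 else 0)"
proof -
  let ?e = "\<lambda>b. ext_incl (\<lambda>c. if c = b then 1 else 0)"
  have "wedge_list (map ?e xs) = (\<lambda>T. if T = set xs then 1 else 0)" if "sorted_wrt (<) xs" for xs :: "'a list"
    using that
  proof (induction xs)
    case Nil
    show ?case
      by (auto simp: wedge_list_def ext_one_def)
  next
    case (Cons b xs)
    have e: "?e b T = (if T = {b} then 1 else 0)" for T
      by (auto simp: ext_incl_def is_singleton_def)
    have b: "b \<notin> set xs" and less: "\<forall>c\<in>set xs. b < c"
      using Cons.prems by auto
    have "wedge_list (map ?e (b # xs)) T = (if T = set (b # xs) then 1 else 0)" for T
    proof -
      have "wedge_list (map ?e (b # xs)) T =
          (\<Sum>R\<in>Pow T. shuffle_sign R (T - R) * ?e b R * (if T - R = set xs then 1 else 0))"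
        using Cons by (simp add: wedge_list_def wedge_def)
      also have "\<dots> = (\<Sum>R\<in>Pow T. if R = {b} then (if T = set (b # xs) then 1 else 0) else 0)"
      proof (rule sum.cong[OF refl])
        fix R
        assume R: "R \<in> Pow T"
        have inv: "{(t, u). t \<in> {b} \<and> u \<in> set xs \<and> u < t} = {}"
          using less by force
        have "shuffle_sign {b} (set xs) = 1"
          unfolding shuffle_sign_def inv by simp
        moreover have "T - {b} = set xs \<longleftrightarrow> T = set (b # xs)" if "b \<in> T"
          using b that by auto
        ultimately show "shuffle_sign R (T - R) * ?e b R * (if T - R = set xs then 1 else 0) =
            (if R = {b} then (if T = set (b # xs) then 1 else 0) else 0)"
          using R by (auto simp: e)
      qed
      also have "\<dots> = (if T = set (b # xs) then 1 else 0)"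
      proof (cases "finite T")
        case True
        thus ?thesis by (auto simp: sum.delta)
      next
        case False
        hence "T \<noteq> set (b # xs)" by (metis List.finite_set)
        thus ?thesis using False by simp
      qed
      finally show ?thesis .
    qed
    thus ?case by blast
  qed
  from this[of "sorted_list_of_set S"] show ?thesis
    using assms by simp
qed


section \<open>The tensor space and the action of \<open>GL(k)\<^sup>d\<close>\<close>

text \<open>
  \<open>V\<close> is the \<open>d\<close>-fold tensor power of \<open>\<complex>\<^sup>k\<close>, with basis \<open>cube d k\<close>: the list \<open>I\<close> stands for
  \<open>e\<^bsub>I ! 0\<^esub> \<otimes> \<dots> \<otimes> e\<^bsub>I ! (d - 1)\<^esub>\<close>.
\<close>

definition pure_tensor :: "nat \<Rightarrow> nat \<Rightarrow> (nat \<Rightarrow> complex vec) \<Rightarrow> nat list \<Rightarrow> complex" where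
  "pure_tensor d k x = (\<lambda>I. if I \<in> cube d k then \<Prod>j<d. x j $ (I ! j) else 0)"

abbreviation ext_V :: "nat \<Rightarrow> nat \<Rightarrow> nat list ext set" where
  "ext_V d k \<equiv> ext_space (cube d k)"

text \<open>
  The action on the exterior algebra: \<open>g\<close> sends the basis vector indexed by \<open>T\<close> to the wedge product
  of the vectors \<open>g\<^sub>0 e\<^bsub>I ! 0\<^esub> \<otimes> \<dots> \<otimes> g\<^bsub>d-1\<^esub> e\<^bsub>I ! (d - 1)\<^esub>\<close> for \<open>I \<in> T\<close>.
  The matrices \<open>g j\<close> with \<open>j < d\<close> are meant to be invertible of size \<open>k\<close>.
\<close>

definition act :: "nat \<Rightarrow> nat \<Rightarrow> (nat \<Rightarrow> complex mat) \<Rightarrow> nat list ext \<Rightarrow> nat list ext" where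
  "act d k g v = (\<lambda>S. \<Sum>T\<in>Pow (cube d k). v T *
     wedge_list (map (\<lambda>I. ext_incl (pure_tensor d k (\<lambda>j. g j *\<^sub>v unit_vec k (I ! j))))
       (sorted_list_of_set T)) S)"

definition unitriangular :: "nat \<Rightarrow> complex mat set" where
  "unitriangular k = {A \<in> carrier_mat k k. upper_triangular A \<and> (\<forall>i<k. A $$ (i, i) = 1)}"

definition weight_vector :: "nat \<Rightarrow> nat \<Rightarrow> (nat \<Rightarrow> nat \<Rightarrow> int) \<Rightarrow> nat list ext \<Rightarrow> bool" where
  "weight_vector d k \<mu> v \<longleftrightarrow> v \<in> ext_V d k \<and>
     (\<forall>a. (\<forall>j<d. \<forall>i<k. a j i \<noteq> 0) \<longrightarrow>
       act d k (\<lambda>j. mat_diag k (a j)) v =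
         (\<lambda>S. (\<Prod>j<d. \<Prod>i<k. a j i powi \<mu> j i) * v S))"

text \<open>The zero vector satisfies both conditions and hence belongs to \<open>HWV d k \<mu>\<close>.\<close>

definition HWV :: "nat \<Rightarrow> nat \<Rightarrow> (nat \<Rightarrow> nat \<Rightarrow> int) \<Rightarrow> nat list ext set" where
  "HWV d k \<mu> = {v. weight_vector d k \<mu> v \<and>
     (\<forall>g. (\<forall>j<d. g j \<in> unitriangular k) \<longrightarrow> act d k g v = v)}"

definition cayley_form :: "nat \<Rightarrow> nat \<Rightarrow> nat list ext" where
  "cayley_form d k = (\<lambda>S. \<Sum>\<pi>\<in>{..<d} \<rightarrow>\<^sub>E {p. p permutes {..<k}}.
     of_int (\<Prod>j<d. sign (\<pi> j)) *
     wedge_list (map (\<lambda>i. ext_incl (pure_tensor d k (\<lambda>j. unit_vec k (\<pi> j i)))) [0..<k]) S)"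

text \<open>
  By \<open>wedge_linear_right\<close> this map is linear, so that it, or a power of it, is an isomorphism
  between two subspaces if and only if it is a bijection between them.
\<close>

definition cayley_wedge :: "nat \<Rightarrow> nat \<Rightarrow> nat list ext \<Rightarrow> nat list ext" where
  "cayley_wedge d k v = wedge (cayley_form d k) v"


section \<open>Latin hypercubes and Alon--Tarsi numbers\<close>

definition slice :: "nat \<Rightarrow> nat \<Rightarrow> nat \<Rightarrow> nat \<Rightarrow> nat list set" where
  "slice d k l i = {I \<in> cube d k. I ! l = i}"

definition latin_hypercubes :: "nat \<Rightarrow> nat \<Rightarrow> (nat list \<Rightarrow> nat) set" where
  "latin_hypercubes d k = {C \<in> cube d k \<rightarrow>\<^sub>E {..<k ^ (d - 1)}.
     \<forall>l<d. \<forall>i<k. bij_betw C (slice d k l i) {..<k ^ (d - 1)}}"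

text \<open>The \<open>S\<close>-permutation in one-line notation is the list of values; outside \<open>{..<card S}\<close> it is the identity.\<close>

definition slice_perm :: "(nat list \<Rightarrow> nat) \<Rightarrow> nat list set \<Rightarrow> nat \<Rightarrow> nat" where
  "slice_perm C S = (\<lambda>m. if m < card S then map C (sorted_list_of_set S) ! m else m)"

definition latin_sign :: "nat \<Rightarrow> nat \<Rightarrow> (nat list \<Rightarrow> nat) \<Rightarrow> int" where
  "latin_sign d k C = (\<Prod>l<d. \<Prod>i<k. sign (slice_perm C (slice d k l i)))"

definition alon_tarsi :: "nat \<Rightarrow> nat \<Rightarrow> int" where
  "alon_tarsi d k = (\<Sum>C\<in>latin_hypercubes d k. latin_sign d k C)"

end

theory Submission
  imports Defs
begin

text \<open>
  Put \<open>N = k\<^bsup>d-1\<^esup>\<close>. For \<open>n = 0\<close> the hypothesis makes \<open>L\<^sup>N\<close> injective on a space containing \<open>1\<close>,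
  so \<open>\<omega>\<^sup>N \<noteq> 0\<close>. Expanding \<open>\<omega>\<^sup>N\<close>, a term is a family of permutations \<open>F m j\<close> (\<open>m < N\<close>, \<open>j < d\<close>);
  it vanishes unless its \<open>k N\<close> points \<open>(F m 0 i, \<dots>, F m (d - 1) i)\<close> are distinct, and then
  labelling each point by its block \<open>m\<close> gives a Latin hypercube. As \<open>d\<close> is odd, the term is a fixed
  vector times the sign of this hypercube, and every hypercube arises from the same number of
  families. Hence \<open>\<omega>\<^sup>N\<close> is a multiple of the Alon--Tarsi number.
\<close>

section \<open>Products of vectors\<close>

text \<open>The unit laws are stated at finite sets only. At an infinite set every product takes the
  value 0, because \<open>sum\<close> over an infinite \<open>Pow S\<close> does, so identities of
  functions can be split by finiteness.\<close>

lemma wedge_list_infinite: "infinite S \<Longrightarrow> wedge_list vs S = 0"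
  by (cases vs) (auto simp: wedge_list_def ext_one_def wedge_infinite)

lemma wedge_list_Nil: "wedge_list [] = ext_one"
  by (simp add: wedge_list_def)

lemma wedge_list_Cons: "wedge_list (v # vs) = wedge v (wedge_list vs)"
  by (simp add: wedge_list_def)

lemma wedge_list_append: "wedge_list (us @ vs) = wedge (wedge_list us) (wedge_list vs)"
proof (induction us)
  case Nil
  have "wedge ext_one (wedge_list vs) S = wedge_list vs S" for S
    by (cases "finite S") (simp_all add: wedge_one_left wedge_infinite wedge_list_infinite)
  thus ?case
    by (auto simp: wedge_list_Nil)
qed (simp add: wedge_list_Cons wedge_assoc)

lemma wedge_list_concat: "wedge_list (concat vss) = wedge_list (map wedge_list vss)"
  by (induction vss) (simp_all add: wedge_list_Nil wedge_list_Cons wedge_list_append)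

lemma wedge_zero_right: "wedge v (\<lambda>S. 0) = (\<lambda>S. 0)"
  by (simp add: wedge_def)

lemma wedge_scale_right: "wedge v (\<lambda>S. a * w S) = (\<lambda>S. a * wedge v w S)"
  using wedge_linear_right[of v a w 0 w] by simp

lemma wedge_scale_left: "wedge (\<lambda>S. a * v S) w = (\<lambda>S. a * wedge v w S)"
  using wedge_linear_left[of a v 0 v w] by simp

lemma wedge_sum_left:
  "wedge (\<lambda>S. \<Sum>x\<in>X. a x * v x S) w = (\<lambda>S. \<Sum>x\<in>X. a x * wedge (v x) w S)"
proof
  fix S
  have "wedge (\<lambda>S. \<Sum>x\<in>X. a x * v x S) w S =
      (\<Sum>T\<in>Pow S. \<Sum>x\<in>X. a x * (shuffle_sign T (S - T) * v x T * w (S - T)))"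
    unfolding wedge_def by (simp add: sum_distrib_left sum_distrib_right mult_ac)
  also have "\<dots> = (\<Sum>x\<in>X. a x * wedge (v x) w S)"
    unfolding wedge_def by (subst sum.swap) (simp add: sum_distrib_left)
  finally show "wedge (\<lambda>S. \<Sum>x\<in>X. a x * v x S) w S = (\<Sum>x\<in>X. a x * wedge (v x) w S)" .
qed

lemma wedge_sum_right:
  "wedge v (\<lambda>S. \<Sum>x\<in>X. a x * w x S) = (\<lambda>S. \<Sum>x\<in>X. a x * wedge v (w x) S)"
proof
  fix S
  have "wedge v (\<lambda>S. \<Sum>x\<in>X. a x * w x S) S =
      (\<Sum>T\<in>Pow S. \<Sum>x\<in>X. a x * (shuffle_sign T (S - T) * v T * w x (S - T)))"
    unfolding wedge_def by (simp add: sum_distrib_left sum_distrib_right mult_ac)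
  also have "\<dots> = (\<Sum>x\<in>X. a x * wedge v (w x) S)"
    unfolding wedge_def by (subst sum.swap) (simp add: sum_distrib_left)
  finally show "wedge v (\<lambda>S. \<Sum>x\<in>X. a x * w x S) S = (\<Sum>x\<in>X. a x * wedge v (w x) S)" .
qed

section \<open>Anticommutation of vectors and alternating products\<close>

lemma wedge_incl_commute:
  "wedge (ext_incl x) (ext_incl y) = (\<lambda>S. - wedge (ext_incl y) (ext_incl x) S)"
proof -
  let ?u = "ext_incl x" and ?v = "ext_incl y"
  have add: "ext_incl (\<lambda>b. x b + y b) = (\<lambda>S. 1 * ?u S + 1 * ?v S)"
    by (auto simp: ext_incl_def)
  \<comment> \<open>Polarization: the square of \<open>x + y\<close> vanishes and so do the two pure
    squares, which leaves the mixed terms.\<close>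
  have "(\<lambda>S. 0) = wedge (\<lambda>S. 1 * ?u S + 1 * ?v S) (\<lambda>S. 1 * ?u S + 1 * ?v S)"
    using wedge_incl_self[of "\<lambda>b. x b + y b"] unfolding add by simp
  also have "\<dots> = (\<lambda>S. wedge ?u ?v S + wedge ?v ?u S)"
    unfolding wedge_linear_left wedge_linear_right wedge_incl_self by auto
  finally have "wedge ?u ?v S + wedge ?v ?u S = 0" for S
    by (rule fun_cong[symmetric])
  thus ?thesis
    by (simp add: eq_neg_iff_add_eq_0 fun_eq_iff)
qed

text \<open>The vector passes the factors \<open>ys\<close> one at a time, each at the cost of one
  sign.\<close>

lemma wedge_incl_wedge_list:
  "wedge (ext_incl x) (wedge_list (map ext_incl ys)) =
    (\<lambda>S. (-1) ^ length ys * wedge (wedge_list (map ext_incl ys)) (ext_incl x) S)"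
proof (induction ys)
  case Nil
  have "wedge (ext_incl x) ext_one S = wedge ext_one (ext_incl x) S" for S
    by (cases "finite S") (simp_all add: wedge_one_left wedge_one_right wedge_infinite)
  thus ?case
    by (auto simp: wedge_list_Nil)
next
  case (Cons y ys)
  let ?w = "wedge_list (map ext_incl ys)"
  have "wedge (ext_incl x) (wedge (ext_incl y) ?w) =
      wedge (\<lambda>S. (-1) * wedge (ext_incl y) (ext_incl x) S) ?w"
    by (simp add: wedge_assoc flip: wedge_incl_commute[of x y])
  also have "\<dots> = (\<lambda>S. (-1) * wedge (ext_incl y) (wedge (ext_incl x) ?w) S)"
    by (simp only: wedge_scale_left wedge_assoc)
  also have "\<dots> = (\<lambda>S. (-1) ^ length (y # ys) * wedge (wedge (ext_incl y) ?w) (ext_incl x) S)"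
    by (simp only: Cons.IH wedge_scale_right wedge_assoc) simp
  finally show ?case
    by (simp add: wedge_list_Cons)
qed

lemma wedge_list_incl_swap:
  "wedge_list (map ext_incl (ws @ x # ys @ y # zs)) =
    (\<lambda>S. - wedge_list (map ext_incl (ws @ y # ys @ x # zs)) S)"
proof -
  let ?M = "wedge_list (map ext_incl ys)" and ?Z = "wedge_list (map ext_incl zs)"
  \<comment> \<open>Bringing \<open>a\<close> next to \<open>b\<close> costs a sign that depends
    only on the length of \<open>ys\<close>. It is the same for both orders of \<open>x\<close> and
    \<open>y\<close>, so only the sign of one adjacent exchange survives.\<close>
  have move: "wedge (ext_incl a) (wedge ?M (wedge (ext_incl b) ?Z)) =
      (\<lambda>S. (-1) ^ length ys * wedge ?M (wedge (wedge (ext_incl a) (ext_incl b)) ?Z) S)" for a b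
  proof -
    have "wedge (ext_incl a) (wedge ?M (wedge (ext_incl b) ?Z)) =
        wedge (wedge (ext_incl a) ?M) (wedge (ext_incl b) ?Z)"
      by (simp add: wedge_assoc)
    also have "\<dots> = (\<lambda>S. (-1) ^ length ys * wedge (wedge ?M (ext_incl a)) (wedge (ext_incl b) ?Z) S)"
      unfolding wedge_incl_wedge_list wedge_scale_left by simp
    finally show ?thesis
      by (simp add: wedge_assoc)
  qed
  have comm: "wedge (ext_incl x) (ext_incl y) = (\<lambda>S. (-1) * wedge (ext_incl y) (ext_incl x) S)"
    using wedge_incl_commute[of x y] by simp
  have "wedge (ext_incl x) (wedge ?M (wedge (ext_incl y) ?Z)) =
      (\<lambda>S. (-1) * wedge (ext_incl y) (wedge ?M (wedge (ext_incl x) ?Z)) S)"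
    unfolding move comm wedge_scale_left wedge_scale_right by (simp add: mult_ac)
  hence "wedge (wedge_list (map ext_incl ws)) (wedge (ext_incl x) (wedge ?M (wedge (ext_incl y) ?Z))) =
      (\<lambda>S. (-1) * wedge (wedge_list (map ext_incl ws))
        (wedge (ext_incl y) (wedge ?M (wedge (ext_incl x) ?Z))) S)"
    by (simp only: wedge_scale_right)
  thus ?thesis
    by (simp add: wedge_list_append wedge_list_Cons)
qed

lemma split_list_two:
  assumes "a \<in> set xs" "b \<in> set xs" "a \<noteq> b"
  obtains ws ys zs where "xs = ws @ a # ys @ b # zs" | ws ys zs where "xs = ws @ b # ys @ a # zs"
proof -
  obtain us vs where xs: "xs = us @ a # vs"
    using split_list[OF assms(1)] by blast
  have "b \<in> set us \<or> b \<in> set vs"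
    using assms xs by auto
  thus ?thesis
  proof
    assume "b \<in> set us"
    then obtain ws ys where "us = ws @ b # ys"
      using split_list by metis
    thus ?thesis using that(2)[of ws ys vs] xs by simp
  next
    assume "b \<in> set vs"
    then obtain ys zs where "vs = ys @ b # zs"
      using split_list by metis
    thus ?thesis using that(1)[of us ys zs] xs by simp
  qed
qed

lemma wedge_list_incl_eq_0:
  assumes "a \<in> set xs" "b \<in> set xs" "a \<noteq> b" "x a = x b"
  shows "wedge_list (map (\<lambda>c. ext_incl (x c)) xs) = (\<lambda>S. 0)"
proof -
  have *: "wedge_list (map ext_incl (ws @ y # ys @ y # zs)) = (\<lambda>S. 0)" for ws y ys zs
  proof
    fix S
    \<comment> \<open>Exchanging two equal vectors does not alter the list, so the product equals
      its own negative.\<close>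
    have "wedge_list (map ext_incl (ws @ y # ys @ y # zs)) S =
        - wedge_list (map ext_incl (ws @ y # ys @ y # zs)) S"
      by (subst wedge_list_incl_swap) simp
    thus "wedge_list (map ext_incl (ws @ y # ys @ y # zs)) S = 0"
      by simp
  qed
  have m: "map (\<lambda>c. ext_incl (x c)) xs = map ext_incl (map x xs)"
    by simp
  from assms(1-3) show ?thesis
    unfolding m
  proof (rule split_list_two)
    fix ws ys zs assume "xs = ws @ a # ys @ b # zs"
    thus "wedge_list (map ext_incl (map x xs)) = (\<lambda>S. 0)"
      using *[of "map x ws" "x a" "map x ys" "map x zs"] assms(4) by simp
  next
    fix ws ys zs assume "xs = ws @ b # ys @ a # zs"
    thus "wedge_list (map ext_incl (map x xs)) = (\<lambda>S. 0)"
      using *[of "map x ws" "x a" "map x ys" "map x zs"] assms(4) by simp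
  qed
qed

text \<open>Indexing the factors by distinct labels turns a transposition of labels into an exchange
  of two positions, even when some of the vectors coincide.\<close>

lemma wedge_list_incl_transpose:
  assumes "distinct xs" "a \<in> set xs" "b \<in> set xs" "a \<noteq> b"
  shows "wedge_list (map (\<lambda>c. ext_incl (x (transpose a b c))) xs) =
    (\<lambda>S. - wedge_list (map (\<lambda>c. ext_incl (x c)) xs) S)"
proof -
  have *: "wedge_list (map (\<lambda>c. ext_incl (x (transpose a b c))) xs) =
      (\<lambda>S. - wedge_list (map (\<lambda>c. ext_incl (x c)) xs) S)"
    if xs: "xs = ws @ a # ys @ b # zs" "distinct xs" for a b ws ys zs
  proof -
    have "map (\<lambda>c. x (transpose a b c)) us = map x us" if "a \<notin> set us" "b \<notin> set us" for us
      using that by (auto simp: transpose_def)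
    hence "map (\<lambda>c. x (transpose a b c)) xs = map x ws @ x b # map x ys @ x a # map x zs"
      using xs by auto
    hence "wedge_list (map ext_incl (map (\<lambda>c. x (transpose a b c)) xs)) =
        (\<lambda>S. - wedge_list (map ext_incl (map x ws @ x a # map x ys @ x b # map x zs)) S)"
      by (simp only: wedge_list_incl_swap[of "map x ws" "x b"])
    thus ?thesis
      using xs(1) by (simp add: o_def)
  qed
  from assms(2-4) show ?thesis
  proof (rule split_list_two)
    fix ws ys zs assume "xs = ws @ a # ys @ b # zs"
    thus ?thesis using * assms(1) by blast
  next
    fix ws ys zs assume "xs = ws @ b # ys @ a # zs"
    thus ?thesis using *[of ws b ys a zs] assms(1) by (simp only: transpose_commute)
  qed
qed

lemma wedge_list_incl_permutes:
  assumes "p permutes set xs" "distinct xs"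
  shows "wedge_list (map (\<lambda>c. ext_incl (x (p c))) xs) =
    (\<lambda>S. of_int (sign p) * wedge_list (map (\<lambda>c. ext_incl (x c)) xs) S)"
  using assms(1) finite_set[of xs]
proof (induction p arbitrary: x rule: permutes_induct)
  case id
  show ?case by simp
next
  case (swap a b p)
  have "permutation p"
    using swap by (auto simp: permutation_permutes)
  hence "sign (transpose a b \<circ> p) = - sign p"
    using swap by (simp add: sign_compose permutation_swap_id sign_swap_id)
  \<comment> \<open>The outer transposition is absorbed into the vectors, which is why the induction
    is over arbitrary \<open>x\<close>.\<close>
  thus ?case
    unfolding o_apply swap.IH[of "\<lambda>c. x (transpose a b c)"]
      wedge_list_incl_transpose[OF assms(2) swap.hyps(1-3)] by simp
qed

text \<open>Distributivity: each factor of the power selects one summand. The list is reversed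
  because every further application multiplies on the left, so the latest factor stands
  first.\<close>

lemma wedge_funpow_sum:
  assumes "finite X"
  shows "(wedge (\<lambda>S. \<Sum>x\<in>X. a x * v x S) ^^ n) ext_one =
    (\<lambda>S. \<Sum>F\<in>{..<n} \<rightarrow>\<^sub>E X. (\<Prod>m<n. a (F m)) * wedge_list (map (\<lambda>m. v (F m)) (rev [0..<n])) S)"
proof (induction n)
  case 0
  show ?case by (simp add: wedge_list_Nil)
next
  case (Suc n)
  let ?P = "{..<n} \<rightarrow>\<^sub>E X"
  let ?w = "\<lambda>F. wedge_list (map (\<lambda>m. v (F m)) (rev [0..<n]))"
  have "(wedge (\<lambda>S. \<Sum>x\<in>X. a x * v x S) ^^ Suc n) ext_one =
      (\<lambda>S. \<Sum>x\<in>X. a x * (\<Sum>F\<in>?P. (\<Prod>m<n. a (F m)) * wedge (v x) (?w F) S))"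
    by (simp add: Suc.IH wedge_sum_left wedge_sum_right)
  also have "\<dots> = (\<lambda>S. \<Sum>F\<in>{..<Suc n} \<rightarrow>\<^sub>E X. (\<Prod>m<Suc n. a (F m)) *
      wedge_list (map (\<lambda>m. v (F m)) (rev [0..<Suc n])) S)"
  proof
    fix S
    let ?h = "\<lambda>F. (\<Prod>m<Suc n. a (F m)) * wedge_list (map (\<lambda>m. v (F m)) (rev [0..<Suc n])) S"
    have h: "?h (F(n := x)) = a x * ((\<Prod>m<n. a (F m)) * wedge (v x) (?w F) S)" for F x
    proof -
      have "(\<Prod>m<n. a ((F(n := x)) m)) = (\<Prod>m<n. a (F m))"
        by (rule prod.cong) auto
      moreover have "map (\<lambda>m. v ((F(n := x)) m)) (rev [0..<n]) = map (\<lambda>m. v (F m)) (rev [0..<n])"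
        by (rule map_cong) auto
      moreover have "rev [0..<Suc n] = n # rev [0..<n]"
        by simp
      ultimately show ?thesis
        by (simp only: list.map wedge_list_Cons prod.lessThan_Suc fun_upd_same mult_ac)
    qed
    have "(\<Sum>F\<in>{..<Suc n} \<rightarrow>\<^sub>E X. ?h F) = (\<Sum>(x, F)\<in>X \<times> ?P. ?h (F(n := x)))"
      unfolding lessThan_Suc PiE_insert_eq
      by (subst sum.reindex[OF inj_combinator]) (auto simp: case_prod_unfold)
    also have "\<dots> = (\<Sum>x\<in>X. a x * (\<Sum>F\<in>?P. (\<Prod>m<n. a (F m)) * wedge (v x) (?w F) S))"
      unfolding h sum_distrib_left by (simp add: sum.cartesian_product)
    finally show "(\<Sum>x\<in>X. a x * (\<Sum>F\<in>?P. (\<Prod>m<n. a (F m)) * wedge (v x) (?w F) S)) =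
        (\<Sum>F\<in>{..<Suc n} \<rightarrow>\<^sub>E X. ?h F)"
      by simp
  qed
  finally show ?case .
qed


section \<open>Signs of permutations\<close>

text \<open>Transport along an injection respects composition and takes transpositions to
  transpositions.\<close>

lemma sign_map_permutation:
  assumes "p permutes A" "finite A" "inj_on f A"
  shows "sign (map_permutation A f p) = sign p"
  using assms(1,2)
proof (induction rule: permutes_induct)
  case id
  show ?case using assms(3) by (simp only: map_permutation_id' sign_id)
next
  case (swap a b p)
  have perm: "permutation p" "permutation (map_permutation A f p)"
    using swap assms(2,3) map_permutation_permutes[of f A "f ` A" p]
    by (auto simp: permutation_permutes inj_on_imp_bij_betw)
  have "map_permutation A f (transpose a b \<circ> p) = transpose (f a) (f b) \<circ> map_permutation A f p"
    using swap assms(3) by (simp add: map_permutation_compose' map_permutation_transpose)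
  moreover have "f a \<noteq> f b"
    using swap assms(3) by (auto dest: inj_onD)
  ultimately show ?case
    using swap perm by (simp add: sign_compose permutation_swap_id sign_swap_id del: o_apply)
qed

text \<open>The map \<open>f\<close> embeds disjoint copies of \<open>K\<close>, one for each member
  of \<open>M\<close>, and \<open>q\<close> is a product of permutations each supported on one copy.
  A general \<open>f\<close> allows the fibres to be the rows or the columns of a grid.\<close>

lemma fibrewise_permutation:
  assumes "finite M" "finite K" "\<And>m. m \<in> M \<Longrightarrow> p m permutes K"
    and "inj_on (case_prod f) (M \<times> K)"
    and "\<And>m x. m \<in> M \<Longrightarrow> x \<in> K \<Longrightarrow> q (f m x) = f m (p m x)"
    and "\<And>y. y \<notin> case_prod f ` (M \<times> K) \<Longrightarrow> q y = y"
  shows "q permutes case_prod f ` (M \<times> K) \<and> sign q = (\<Prod>m\<in>M. sign (p m))"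
  using assms(1,3-)
proof (induction M arbitrary: q rule: finite_induct)
  case empty
  have "q y = y" for y
    by (rule empty.prems(4)) simp
  hence q: "q = id"
    by (intro ext) simp
  show ?case
    unfolding q by (intro conjI permutes_id) (simp only: sign_id prod.empty)
next
  case (insert n M)
  let ?I = "\<lambda>M. case_prod f ` (M \<times> K)"
  \<comment> \<open>\<open>r\<close> is the part of \<open>q\<close> on the copies treated so far
    and \<open>s\<close> the part on the new copy; their supports are disjoint.\<close>
  define r where "r y = (if y \<in> ?I M then q y else y)" for y
  define s where "s = map_permutation K (f n) (p n)"
  have I_insert: "?I (insert n M) = f n ` K \<union> ?I M"
    by force
  have inj: "inj_on (f n) K"
    using insert.prems(2) by (auto simp: inj_on_def)
  have s: "s permutes f n ` K"
    unfolding s_def using insert.prems(1) inj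
    by (intro map_permutation_permutes) (auto simp: inj_on_imp_bij_betw)
  have disj: "f n x \<notin> ?I M" if "x \<in> K" for x
  proof
    assume "f n x \<in> ?I M"
    then obtain m y where "m \<in> M" "y \<in> K" "case_prod f (n, x) = case_prod f (m, y)"
      by auto
    thus False
      using inj_onD[OF insert.prems(2), of "(n, x)" "(m, y)"] insert.hyps that by auto
  qed
  have r: "r permutes ?I M \<and> sign r = (\<Prod>m\<in>M. sign (p m))"
  proof (rule insert.IH)
    show "inj_on (case_prod f) (M \<times> K)"
      using insert.prems(2) by (rule inj_on_subset) auto
  qed (use insert.prems in \<open>auto simp: r_def\<close>)
  have q: "q = s \<circ> r"
  proof
    fix y
    consider "y \<in> ?I M" | x where "x \<in> K" "y = f n x" | "y \<notin> ?I (insert n M)"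
      unfolding I_insert by blast
    thus "q y = (s \<circ> r) y"
    proof cases
      case 1
      hence "r y \<in> ?I M"
        using r by (simp add: permutes_in_image)
      hence "r y \<notin> f n ` K"
        using disj by (metis imageE)
      hence "s (r y) = r y"
        by (rule permutes_not_in[OF s])
      thus ?thesis
        using 1 by (simp only: r_def if_True o_apply)
    next
      case 2
      thus ?thesis
        using disj[OF 2(1)] insert.prems(3)[of n x]
        by (simp only: r_def s_def o_apply if_False map_permutation_apply[OF inj] insertI1)
    next
      case 3
      hence "y \<notin> f n ` K" "y \<notin> ?I M"
        unfolding I_insert by auto
      thus ?thesis
        using permutes_not_in[OF s] insert.prems(4)[OF 3] by (simp only: r_def if_False o_apply not_False_eq_True)
    qed
  qed
  have sub: "f n ` K \<subseteq> ?I (insert n M)" "?I M \<subseteq> ?I (insert n M)"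
    unfolding I_insert by auto
  have "permutation s" "permutation r"
    using r insert.hyps assms(2) by (auto intro: permutes_imp_permutation[OF _ s] permutes_imp_permutation[of "?I M"])
  moreover have "sign s = sign (p n)"
    unfolding s_def using insert.prems(1) assms(2) inj by (simp add: sign_map_permutation)
  ultimately have "sign q = (\<Prod>m\<in>insert n M. sign (p m))"
    using r insert.hyps by (simp add: q sign_compose)
  moreover have "q permutes ?I (insert n M)"
    unfolding q using r
    by (intro permutes_compose permutes_subset[OF s sub(1)] permutes_subset[OF _ sub(2)]) simp
  ultimately show ?case by blast
qed

text \<open>For two enumerations of one set by \<open>G\<close>, this is the reordering of indices
  that turns \<open>f\<close> into \<open>g\<close>; its sign compares the two orders.
  \<open>restrict_id\<close> supplies the fixed points outside \<open>G\<close> that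
  \<open>permutes\<close> requires.\<close>

definition transition :: "'a set \<Rightarrow> ('a \<Rightarrow> 'b) \<Rightarrow> ('a \<Rightarrow> 'b) \<Rightarrow> 'a \<Rightarrow> 'a" where
  "transition G f g = restrict_id (inv_into G f \<circ> g) G"

lemma transition_permutes:
  assumes "bij_betw f G X" "bij_betw g G X"
  shows "transition G f g permutes G"
  unfolding transition_def
  using bij_betw_trans[OF assms(2) bij_betw_inv_into[OF assms(1)]]
  by (intro bij_imp_permutes bij_betw_restrict_id) auto

lemma transition_apply:
  assumes "bij_betw f G X" "bij_betw g G X" "p \<in> G"
  shows "f (transition G f g p) = g p"
  using assms bij_betwE by (fastforce simp: transition_def bij_betw_inv_into_right)

text \<open>Reorderings compose, since injectivity of \<open>f\<close> determines each of their
  values, and \<open>sign\<close> is multiplicative.\<close>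

lemma sign_transition_trans:
  assumes "finite G" "bij_betw f G X" "bij_betw g G X" "bij_betw h G X"
  shows "sign (transition G f h) = sign (transition G f g) * sign (transition G g h)"
proof -
  have p: "transition G f g permutes G" "transition G g h permutes G" "transition G f h permutes G"
    using assms by (auto intro: transition_permutes)
  have "transition G f h x = (transition G f g \<circ> transition G g h) x" for x
  proof (cases "x \<in> G")
    case True
    hence y: "transition G g h x \<in> G"
      using p by (simp add: permutes_in_image)
    have "f (transition G f h x) = f (transition G f g (transition G g h x))"
      using True y assms by (simp add: transition_apply)
    moreover have "transition G f h x \<in> G" "transition G f g (transition G g h x) \<in> G"
      using True y p by (simp_all add: permutes_in_image)
    ultimately show ?thesis
      using assms(2) by (auto simp: bij_betw_def dest: inj_onD)
  qed (use p in \<open>simp add: permutes_not_in\<close>)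
  hence "transition G f h = transition G f g \<circ> transition G g h"
    by blast
  moreover have "permutation (transition G f g)" "permutation (transition G g h)"
    using p assms(1) by (auto intro: permutes_imp_permutation)
  ultimately show ?thesis
    by (simp only: sign_compose)
qed


section \<open>Families of permutations and Latin hypercubes\<close>

lemma sorted_list_of_set_nth_bij_betw:
  assumes "finite S"
  shows "bij_betw (\<lambda>r. sorted_list_of_set S ! r) {..<card S} S"
  using bij_betw_nth[of "sorted_list_of_set S" "{..<card S}" S] assms by simp

locale hypercube =
  fixes d k :: nat
  assumes d_pos: "0 < d"
begin

definition N :: nat where
  "N = k ^ (d - 1)"

text \<open>For \<open>point F\<close>, the pair \<open>(m, i)\<close> stands for the
  \<open>i\<close>-th vector in the \<open>m\<close>-th Cayley form; for \<open>slice_point\<close>,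
  a pair is a rank within a slice followed by the number of the slice.\<close>

definition grid :: "(nat \<times> nat) set" where
  "grid = {..<N} \<times> {..<k}"

definition families :: "(nat \<Rightarrow> nat \<Rightarrow> nat \<Rightarrow> nat) set" where
  "families = {..<N} \<rightarrow>\<^sub>E ({..<d} \<rightarrow>\<^sub>E {p. p permutes {..<k}})"

definition point :: "(nat \<Rightarrow> nat \<Rightarrow> nat \<Rightarrow> nat) \<Rightarrow> nat \<times> nat \<Rightarrow> nat list" where
  "point F = (\<lambda>(m, i). map (\<lambda>j. F m j i) [0..<d])"

text \<open>The inverse is meaningful only when \<open>point F\<close> is injective on
  \<open>grid\<close>. \<open>restrict\<close> gives the default value off the cube that
  \<open>latin_hypercubes\<close> demands.\<close>

definition labelling :: "(nat \<Rightarrow> nat \<Rightarrow> nat \<Rightarrow> nat) \<Rightarrow> nat list \<Rightarrow> nat" where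
  "labelling F = restrict (\<lambda>I. fst (inv_into grid (point F) I)) (cube d k)"

definition slice_point :: "nat \<Rightarrow> nat \<times> nat \<Rightarrow> nat list" where
  "slice_point l = (\<lambda>(r, i). sorted_list_of_set (slice d k l i) ! r)"

lemma finite_grid: "finite grid"
  by (simp add: grid_def)

lemma finite_families: "finite families"
  unfolding families_def by (intro finite_PiE finite_permutations) simp_all

lemma finite_cube: "finite (cube d k)"
  using finite_lists_length_eq[of "{..<k}" d] by (simp add: cube_def conj_commute)

lemma card_grid: "card grid = card (cube d k)"
proof -
  have "card (cube d k) = k ^ d"
    using card_lists_length_eq[of "{..<k}" d] by (simp add: cube_def conj_commute)
  thus ?thesis
    using d_pos by (simp add: grid_def N_def power_eq_if)
qed

lemma cube_nth_less: "I \<in> cube d k \<Longrightarrow> j < d \<Longrightarrow> I ! j < k"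
  by (auto simp: cube_def subset_iff)

lemma families_permutes: "F \<in> families \<Longrightarrow> m < N \<Longrightarrow> j < d \<Longrightarrow> F m j permutes {..<k}"
  unfolding families_def by (metis PiE_mem lessThan_iff mem_Collect_eq)

lemma point_nth: "j < d \<Longrightarrow> point F (m, i) ! j = F m j i"
  by (simp add: point_def)

lemma point_in_cube:
  assumes "F \<in> families" "p \<in> grid"
  shows "point F p \<in> cube d k"
proof -
  obtain m i where p: "p = (m, i)" "m < N" "i < k"
    using assms by (auto simp: grid_def)
  have "F m j i < k" if "j < d" for j
    using permutes_in_image[OF families_permutes[OF assms(1) p(2) that]] p(3) by simp
  thus ?thesis
    using p by (auto simp: point_def cube_def)
qed

text \<open>The grid and the cube have equally many elements, so injectivity suffices.\<close>

lemma bij_betw_point: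
  assumes "F \<in> families" "inj_on (point F) grid"
  shows "bij_betw (point F) grid (cube d k)"
proof -
  have "point F ` grid = cube d k"
  proof (rule card_subset_eq[OF finite_cube])
    show "point F ` grid \<subseteq> cube d k"
      using point_in_cube[OF assms(1)] by blast
    show "card (point F ` grid) = card (cube d k)"
      by (simp only: card_image[OF assms(2)] card_grid)
  qed
  thus ?thesis
    using assms(2) by (simp add: bij_betw_def)
qed

section \<open>Correspondence between families with distinct points and Latin hypercubes\<close>

lemma labelling_point:
  assumes "F \<in> families" "inj_on (point F) grid" "(m, i) \<in> grid"
  shows "labelling F (point F (m, i)) = m"
  using assms by (simp add: labelling_def point_in_cube)

text \<open>Block \<open>m\<close> meets the slice \<open>i\<close> in direction \<open>l\<close>
  exactly once, because the permutation \<open>F m l\<close> takes the value \<open>i\<close>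
  exactly once.\<close>

lemma labelling_in_latin_hypercubes:
  assumes F: "F \<in> families" and inj: "inj_on (point F) grid"
  shows "labelling F \<in> latin_hypercubes d k"
proof -
  note bij = bij_betw_point[OF F inj] and label = labelling_point[OF F inj]
  have ex: "\<exists>m i. I = point F (m, i) \<and> (m, i) \<in> grid" if "I \<in> cube d k" for I
    using bij that by (force simp: bij_betw_def)
  have "labelling F I < N" if "I \<in> cube d k" for I
    using ex[OF that] label by (auto simp: grid_def)
  hence "labelling F \<in> cube d k \<rightarrow>\<^sub>E {..<N}"
    by (auto simp: labelling_def)
  moreover have "bij_betw (labelling F) (slice d k l i) {..<N}" if l: "l < d" and i: "i < k" for l i
  proof (rule bij_betw_imageI)
    show "inj_on (labelling F) (slice d k l i)"
    proof (rule inj_onI)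
      fix I J
      assume IJ: "I \<in> slice d k l i" "J \<in> slice d k l i" "labelling F I = labelling F J"
      obtain m a where I: "I = point F (m, a)" "(m, a) \<in> grid"
        using ex[of I] IJ(1) by (auto simp: slice_def)
      obtain n b where J: "J = point F (n, b)" "(n, b) \<in> grid"
        using ex[of J] IJ(2) by (auto simp: slice_def)
      have "m = n"
        using IJ(3) I J label by simp
      moreover have "F m l a = i" "F n l b = i"
        using IJ I J l by (auto simp: slice_def point_nth)
      moreover have "F m l permutes {..<k}"
        using F I l by (intro families_permutes) (auto simp: grid_def)
      ultimately show "I = J"
        using I J injD[OF permutes_inj, of "F m l" "{..<k}" a b] by simp
    qed
    show "labelling F ` slice d k l i = {..<N}"
    proof (intro equalityI subsetI)
      fix m assume "m \<in> labelling F ` slice d k l i"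
      thus "m \<in> {..<N}"
        using \<open>\<And>I. I \<in> cube d k \<Longrightarrow> labelling F I < N\<close> by (auto simp: slice_def)
    next
      fix m assume m: "m \<in> {..<N}"
      hence perm: "F m l permutes {..<k}"
        using F l by (auto intro: families_permutes)
      have "i \<in> F m l ` {..<k}"
        using i permutes_image[OF perm] by simp
      then obtain a where a: "a < k" "F m l a = i"
        by auto
      hence "(m, a) \<in> grid"
        using m by (simp add: grid_def)
      moreover from this have "point F (m, a) \<in> slice d k l i"
        using a l F point_in_cube by (simp add: slice_def point_nth)
      ultimately show "m \<in> labelling F ` slice d k l i"
        using label by force
    qed
  qed
  ultimately show ?thesis
    by (simp add: latin_hypercubes_def N_def)
qed

lemma latin_bij_betw:
  "C \<in> latin_hypercubes d k \<Longrightarrow> l < d \<Longrightarrow> i < k \<Longrightarrow> bij_betw C (slice d k l i) {..<N}"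
  by (simp add: latin_hypercubes_def N_def)

lemma latin_eqI:
  assumes "C \<in> latin_hypercubes d k" "I \<in> cube d k" "J \<in> cube d k" "l < d"
    and "I ! l = J ! l" "C I = C J"
  shows "I = J"
proof -
  have "inj_on C (slice d k l (I ! l))"
    using latin_bij_betw[OF assms(1,4)] cube_nth_less[OF assms(2,4)] by (auto simp: bij_betw_def)
  thus ?thesis
    using assms by (auto simp: slice_def dest: inj_onD)
qed

text \<open>
  Reordering the factors of the \<open>m\<close>-th block acts simultaneously on all its \<open>d\<close> permutations; fixing
  the permutation in direction \<open>0\<close> of each block leaves exactly one family for each hypercube.
\<close>

lemma bij_betw_labelling:
  assumes \<sigma>: "\<And>m. m < N \<Longrightarrow> \<sigma> m permutes {..<k}"
  shows "bij_betw labelling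
    {F \<in> families. inj_on (point F) grid \<and> (\<forall>m<N. F m 0 = \<sigma> m)} (latin_hypercubes d k)"
    (is "bij_betw _ ?A _")
proof (rule bij_betw_imageI)
  show "inj_on labelling ?A"
  proof (rule inj_onI)
    fix F F'
    assume F: "F \<in> ?A" and F': "F' \<in> ?A" and eq: "labelling F = labelling F'"
    have "F m j i = F' m j i" if "m < N" "j < d" for m j i
    proof (cases "i < k")
      case True
      have mi: "(m, i) \<in> grid"
        using that True by (simp add: grid_def)
      \<comment> \<open>Both points carry the label \<open>m\<close> and have zeroth coordinate
        \<open>\<sigma> m i\<close>.\<close>
      have "point F (m, i) = point F' (m, i)"
      proof (rule latin_eqI[where C = "labelling F" and l = 0])
        show "labelling F (point F (m, i)) = labelling F (point F' (m, i))"
          using F F' mi labelling_point[of F m i] labelling_point[of F' m i] eq by simp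
      qed (use F F' mi that d_pos in \<open>auto simp: labelling_in_latin_hypercubes point_in_cube point_nth\<close>)
      thus ?thesis
        using that by (metis point_nth)
    next
      case False
      have "F m j permutes {..<k}" "F' m j permutes {..<k}"
        using F F' that by (auto intro: families_permutes)
      thus ?thesis
        using False by (simp add: permutes_not_in)
    qed
    hence *: "F m j = F' m j" if "m < N" "j < d" for m j
      using that by blast
    have FF: "F \<in> families" "F' \<in> families"
      using F F' by auto
    have "F m = F' m" if "m < N" for m
    proof -
      have "F m \<in> {..<d} \<rightarrow>\<^sub>E {p. p permutes {..<k}}" "F' m \<in> {..<d} \<rightarrow>\<^sub>E {p. p permutes {..<k}}"
        using FF that unfolding families_def by (auto dest: PiE_mem)
      thus ?thesis
        using * that by (intro PiE_ext) auto
    qed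
    thus "F = F'"
      using FF unfolding families_def by (intro PiE_ext) auto
  qed
  show "labelling ` ?A = latin_hypercubes d k"
  proof (intro equalityI subsetI)
    fix C assume "C \<in> labelling ` ?A"
    thus "C \<in> latin_hypercubes d k"
      by (auto simp: labelling_in_latin_hypercubes)
  next
    fix C assume C: "C \<in> latin_hypercubes d k"
    \<comment> \<open>The only cell with label \<open>m\<close> and zeroth coordinate
      \<open>a\<close>.\<close>
    define h where "h m a = inv_into (slice d k 0 a) C m" for m a
    have h: "h m a \<in> cube d k" "h m a ! 0 = a" "C (h m a) = m" if "m < N" "a < k" for m a
    proof -
      have bij: "bij_betw C (slice d k 0 a) {..<N}"
        using latin_bij_betw[OF C d_pos that(2)] .
      show "C (h m a) = m"
        using bij_betw_inv_into_right[OF bij] that by (simp add: h_def)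
      have "h m a \<in> slice d k 0 a"
        using bij_betwE[OF bij_betw_inv_into[OF bij]] that by (simp add: h_def)
      thus "h m a \<in> cube d k" "h m a ! 0 = a"
        by (auto simp: slice_def)
    qed
    have \<sigma>_less: "\<sigma> m i < k" if "m < N" "i < k" for m i
      using permutes_in_image[OF \<sigma>[OF that(1)]] that(2) by simp
    \<comment> \<open>The prescribed zeroth coordinate \<open>\<sigma> m i\<close> and the label
      \<open>m\<close> force the \<open>i\<close>-th point of block \<open>m\<close>; its
      coordinates are the values of the permutations sought.\<close>
    define F where "F = (\<lambda>m\<in>{..<N}. \<lambda>j\<in>{..<d}. \<lambda>i. if i < k then h m (\<sigma> m i) ! j else i)"
    have perm: "F m j permutes {..<k}" if m: "m < N" and j: "j < d" for m j
    proof (rule bij_imp_permutes)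
      have sub: "F m j ` {..<k} \<subseteq> {..<k}"
        using m j h \<sigma>_less cube_nth_less by (auto simp: F_def)
      have "inj_on (F m j) {..<k}"
      proof (rule inj_onI)
        fix a b assume ab: "a \<in> {..<k}" "b \<in> {..<k}" "F m j a = F m j b"
        \<comment> \<open>Two cells with the same label \<open>m\<close> that agree in coordinate
          \<open>j\<close> coincide.\<close>
        have "h m (\<sigma> m a) = h m (\<sigma> m b)"
          by (rule latin_eqI[OF C, where l = j]) (use ab m j h \<sigma>_less in \<open>auto simp: F_def\<close>)
        hence "\<sigma> m a = \<sigma> m b"
          using ab m h \<sigma>_less by (metis lessThan_iff)
        thus "a = b"
          using injD[OF permutes_inj[OF \<sigma>[OF m]]] by blast
      qed
      thus "bij_betw (F m j) {..<k} {..<k}"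
        using sub by (simp add: bij_betw_def endo_inj_surj)
    qed (use m j in \<open>simp add: F_def\<close>)
    hence F: "F \<in> families"
      by (auto simp: families_def F_def PiE_iff)
    have point: "point F (m, i) = h m (\<sigma> m i)" if "m < N" "i < k" for m i
      using that h[OF that(1) \<sigma>_less[OF that]]
      by (intro nth_equalityI) (auto simp: point_def F_def cube_def)
    have label: "C (point F (m, i)) = m" "point F (m, i) ! 0 = \<sigma> m i" if "m < N" "i < k" for m i
      using that h \<sigma>_less by (auto simp: point)
    have inj: "inj_on (point F) grid"
    proof (rule inj_onI)
      fix p q assume pq: "p \<in> grid" "q \<in> grid" "point F p = point F q"
      obtain m i n j where mn: "p = (m, i)" "q = (n, j)" "m < N" "i < k" "n < N" "j < k"
        using pq by (auto simp: grid_def)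
      have "m = n"
        using label(1)[of m i] label(1)[of n j] pq(3) mn by simp
      moreover from this have "\<sigma> m i = \<sigma> m j"
        using label(2)[of m i] label(2)[of n j] pq(3) mn by simp
      hence "i = j"
        using injD[OF permutes_inj[OF \<sigma>[OF mn(3)]]] by blast
      ultimately show "p = q"
        using mn by simp
    qed
    have "F m 0 = \<sigma> m" if m: "m < N" for m
    proof
      fix i
      show "F m 0 i = \<sigma> m i"
        using m d_pos h \<sigma>_less \<sigma>[OF m] by (simp add: F_def permutes_not_in)
    qed
    hence "F \<in> ?A"
      using F inj by simp
    moreover have "labelling F = C"
    proof
      fix I
      show "labelling F I = C I"
      proof (cases "I \<in> cube d k")
        case True
        then obtain m i where "I = point F (m, i)" "(m, i) \<in> grid"
          using bij_betw_point[OF F inj] by (force simp: bij_betw_def)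
        thus ?thesis
          using label labelling_point[OF F inj] by (simp add: grid_def)
      next
        case False
        thus ?thesis
          using C by (auto simp: labelling_def latin_hypercubes_def PiE_def extensional_def)
      qed
    qed
    ultimately show "C \<in> labelling ` ?A"
      by blast
  qed
qed

section \<open>Enumerating the cube slice by slice\<close>

lemma card_slice:
  assumes "C \<in> latin_hypercubes d k" "l < d" "i < k"
  shows "card (slice d k l i) = N"
  using bij_betw_same_card[OF latin_bij_betw[OF assms]] by simp

lemma finite_slice: "finite (slice d k l i)"
  using finite_cube by (simp add: slice_def)

lemma slice_point_in_slice:
  assumes "C \<in> latin_hypercubes d k" "l < d" "(r, i) \<in> grid"
  shows "slice_point l (r, i) \<in> slice d k l i"
  using bij_betwE[OF sorted_list_of_set_nth_bij_betw[OF finite_slice[of l i]]]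
    card_slice[OF assms(1,2)] assms(3)
  by (simp add: slice_point_def grid_def)

text \<open>The slices in one direction partition the cube. The hypercube \<open>C\<close> is
  present because \<open>card_slice\<close> reads the size of a slice off its bijections.\<close>

lemma bij_betw_slice_point:
  assumes "C \<in> latin_hypercubes d k" "l < d"
  shows "bij_betw (slice_point l) grid (cube d k)"
proof -
  note slice = slice_point_in_slice[OF assms]
  have inj: "inj_on (slice_point l) grid"
  proof (rule inj_onI)
    fix p q assume pq: "p \<in> grid" "q \<in> grid" "slice_point l p = slice_point l q"
    obtain r i s j where rs: "p = (r, i)" "q = (s, j)"
      by (cases p, cases q) blast
    have ij: "i = j"
      using slice[of r i] slice[of s j] pq rs by (auto simp: slice_def)
    have "r < N" "s < N" "i < k"
      using pq rs by (auto simp: grid_def)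
    moreover from \<open>i < k\<close> have "inj_on (\<lambda>r. sorted_list_of_set (slice d k l i) ! r) {..<N}"
      using sorted_list_of_set_nth_bij_betw[OF finite_slice[of l i]] card_slice[OF assms]
      by (simp add: bij_betw_def)
    ultimately have "r = s"
      using pq(3) rs ij by (auto simp: slice_point_def dest: inj_onD)
    thus "p = q"
      using rs ij by simp
  qed
  have "slice_point l ` grid \<subseteq> cube d k"
    using slice by (force simp: slice_def)
  hence "slice_point l ` grid = cube d k"
    by (intro card_subset_eq[OF finite_cube]) (simp_all only: card_image[OF inj] card_grid)
  thus ?thesis
    using inj by (simp add: bij_betw_def)
qed

lemma slice_perm_permutes:
  assumes "C \<in> latin_hypercubes d k" "l < d" "i < k"
  shows "slice_perm C (slice d k l i) permutes {..<N}"
proof (rule bij_imp_permutes)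
  note card = card_slice[OF assms]
  have "bij_betw (C \<circ> (\<lambda>r. sorted_list_of_set (slice d k l i) ! r)) {..<N} {..<N}"
    using bij_betw_trans[OF sorted_list_of_set_nth_bij_betw[OF finite_slice] latin_bij_betw[OF assms]]
    by (simp add: card)
  moreover have "slice_perm C (slice d k l i) r = (C \<circ> (\<lambda>r. sorted_list_of_set (slice d k l i) ! r)) r"
    if "r \<in> {..<N}" for r
    using that by (simp add: slice_perm_def card)
  ultimately show "bij_betw (slice_perm C (slice d k l i)) {..<N} {..<N}"
    using bij_betw_cong[of "{..<N}" "slice_perm C (slice d k l i)"] by blast
qed (simp add: slice_perm_def card_slice[OF assms])

lemma latin_slice_point:
  assumes "C \<in> latin_hypercubes d k" "l < d" "(r, i) \<in> grid"
  shows "C (slice_point l (r, i)) = slice_perm C (slice d k l i) r"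
  using assms card_slice[OF assms(1,2)] by (simp add: slice_perm_def slice_point_def grid_def)

text \<open>
  Both \<open>slice_point l\<close> and \<open>point F\<close> become permutations of the grid after composing with
  \<open>I \<mapsto> (labelling F I, I ! l)\<close>: the former acts by the slice permutations on the columns, the
  latter by the permutations \<open>F m l\<close> on the rows.
\<close>

lemma sign_point:
  assumes F: "F \<in> families" and inj: "inj_on (point F) grid" and l: "l < d"
  shows "(\<Prod>m<N. sign (F m l)) = (\<Prod>i<k. sign (slice_perm (labelling F) (slice d k l i))) *
    sign (transition grid (slice_point l) (point F))"
proof -
  let ?C = "labelling F" and ?A = "transition grid (slice_point l) (point F)"
  note C = labelling_in_latin_hypercubes[OF F inj]
  let ?s = "\<lambda>i. slice_perm ?C (slice d k l i)"
  define P where "P = (\<lambda>(m, i). if m < N \<and> i < k then (m, F m l i) else (m, i))"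
  define Q where "Q = (\<lambda>(r, i). if r < N \<and> i < k then (?s i r, i) else (r, i))"
  \<comment> \<open>The fibres of \<open>Q\<close> are the columns of the grid, so its embedding
    interchanges the two coordinates.\<close>
  have img: "(\<lambda>(i, r). (r, i)) ` ({..<k} \<times> {..<N}) = grid"
    by (auto simp: grid_def)
  have P: "P permutes grid \<and> sign P = (\<Prod>m<N. sign (F m l))"
  proof -
    have "case_prod Pair ` ({..<N} \<times> {..<k}) = grid"
      by (simp add: grid_def)
    moreover have "P y = y" if "y \<notin> grid" for y
      using that by (cases y) (auto simp: P_def grid_def)
    ultimately show ?thesis
      using fibrewise_permutation[of "{..<N}" "{..<k}" "\<lambda>m. F m l" Pair P] families_permutes[OF F _ l]
      by (simp add: P_def)
  qed
  have Q: "Q permutes grid \<and> sign Q = (\<Prod>i<k. sign (?s i))"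
  proof -
    have "Q y = y" if "y \<notin> grid" for y
      using that by (cases y) (auto simp: Q_def grid_def)
    moreover have "inj_on (\<lambda>(i, r). (r, i)) ({..<k} \<times> {..<N})"
      by (auto simp: inj_on_def)
    ultimately show ?thesis
      using fibrewise_permutation[of "{..<k}" "{..<N}" ?s "\<lambda>i r. (r, i)" Q, unfolded img]
        slice_perm_permutes[OF C l]
      by (simp add: Q_def)
  qed
  note bij = bij_betw_slice_point[OF C l] bij_betw_point[OF F inj]
  note A = transition_permutes[OF bij]
  have PQ: "P permutes grid" "Q permutes grid"
    using P Q by auto
  have "P p = (Q \<circ> ?A) p" for p
  proof (cases "p \<in> grid")
    case True
    then obtain m i where p: "p = (m, i)" "m < N" "i < k"
      by (auto simp: grid_def)
    obtain r a where ra: "?A p = (r, a)" "(r, a) \<in> grid"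
      using permutes_in_image[OF A, of p] True by (cases "?A p") auto
    have "slice_point l (r, a) = point F p"
      using transition_apply[OF bij True] ra by simp
    \<comment> \<open>Label and \<open>l\<close>-th coordinate of this one cell, each read from both
      of its descriptions.\<close>
    hence "?s a r = m" "a = F m l i"
      using latin_slice_point[OF C l ra(2)] slice_point_in_slice[OF C l ra(2)] p True
        labelling_point[OF F inj] l by (auto simp: slice_def point_nth)
    thus ?thesis
      using p ra by (simp add: P_def Q_def grid_def)
  next
    case False
    thus ?thesis
      by (simp add: permutes_not_in[OF A] permutes_not_in[OF PQ(1)] permutes_not_in[OF PQ(2)])
  qed
  hence "P = Q \<circ> ?A"
    by blast
  moreover have "permutation Q" "permutation ?A"
    using PQ(2) A finite_grid by (auto intro: permutes_imp_permutation)
  ultimately have "sign P = sign Q * sign ?A"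
    by (simp only: sign_compose)
  thus ?thesis
    using P Q by simp
qed

text \<open>
  For odd \<open>d\<close> the sign of a family and the sign of the sequence of its points change together, since
  the latter enters \<open>d + 1\<close> times.
\<close>

lemma sign_family:
  assumes F: "F \<in> families" and inj: "inj_on (point F) grid" and "odd d"
  shows "(\<Prod>m<N. \<Prod>j<d. sign (F m j)) * sign (transition grid (slice_point 0) (point F)) =
    (\<Prod>l<d. sign (transition grid (slice_point 0) (slice_point l))) * latin_sign d k (labelling F)"
proof -
  note C = labelling_in_latin_hypercubes[OF F inj]
  let ?A = "\<lambda>l. sign (transition grid (slice_point l) (point F))"
  let ?K = "\<lambda>l. sign (transition grid (slice_point 0) (slice_point l))"
  let ?L = "\<lambda>l. \<Prod>i<k. sign (slice_perm (labelling F) (slice d k l i))"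
  have "(\<Prod>m<N. sign (F m l)) = ?L l * ?K l * ?A 0" if "l < d" for l
  proof -
    have "?A 0 = ?K l * ?A l"
      by (rule sign_transition_trans[OF finite_grid bij_betw_slice_point[OF C d_pos]
        bij_betw_slice_point[OF C that] bij_betw_point[OF F inj]])
    \<comment> \<open>A sign is its own inverse.\<close>
    hence "?A l = ?K l * ?A 0"
      by simp
    thus ?thesis
      using sign_point[OF F inj that] by simp
  qed
  hence "(\<Prod>l<d. \<Prod>m<N. sign (F m l)) = (\<Prod>l<d. ?L l) * (\<Prod>l<d. ?K l) * ?A 0 ^ d"
    by (simp add: prod.distrib)
  moreover have "(\<Prod>m<N. \<Prod>j<d. sign (F m j)) = (\<Prod>l<d. \<Prod>m<N. sign (F m l))"
    by (rule prod.swap)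
  moreover have "?A 0 ^ d * ?A 0 = 1"
    using \<open>odd d\<close> by (cases "transition grid (slice_point 0) (point F)" rule: sign_cases) auto
  ultimately show ?thesis
    unfolding latin_sign_def mult.commute[of "\<Prod>l<d. ?K l"] by (simp only: mult.assoc mult_1_right)
qed


section \<open>Powers of the Cayley form\<close>

definition basis_vector :: "nat list \<Rightarrow> nat list \<Rightarrow> complex" where
  "basis_vector I = pure_tensor d k (\<lambda>j. unit_vec k (I ! j))"

text \<open>The order in which the factors occur in the expanded power: blocks descending as in
  \<open>wedge_funpow_sum\<close>, positions ascending within a block.\<close>

definition grid_list :: "(nat \<times> nat) list" where
  "grid_list = List.product (rev [0..<N]) [0..<k]"

lemma distinct_grid_list: "distinct grid_list"
  by (simp add: grid_list_def distinct_product)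

lemma set_grid_list: "set grid_list = grid"
  by (auto simp: grid_list_def grid_def)

lemma cayley_wedge_funpow_one:
  "(cayley_wedge d k ^^ N) ext_one = (\<lambda>S. \<Sum>F\<in>families. of_int (\<Prod>m<N. \<Prod>j<d. sign (F m j)) *
    wedge_list (map (\<lambda>p. ext_incl (basis_vector (point F p))) grid_list) S)"
proof -
  define X where "X = {..<d} \<rightarrow>\<^sub>E {p. p permutes {..<k}}"
  define B where "B \<pi> = wedge_list (map (\<lambda>i. ext_incl (pure_tensor d k (\<lambda>j. unit_vec k (\<pi> j i)))) [0..<k])"
    for \<pi> :: "nat \<Rightarrow> nat \<Rightarrow> nat"
  have "finite X"
    unfolding X_def by (intro finite_PiE finite_permutations) simp_all
  moreover have "cayley_wedge d k = wedge (\<lambda>S. \<Sum>\<pi>\<in>X. of_int (\<Prod>j<d. sign (\<pi> j)) * B \<pi> S)"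
    by (simp add: cayley_wedge_def cayley_form_def X_def B_def fun_eq_iff)
  moreover have "wedge_list (map (\<lambda>m. B (F m)) (rev [0..<N])) =
      wedge_list (map (\<lambda>p. ext_incl (basis_vector (point F p))) grid_list)" for F
  proof -
    \<comment> \<open>\<open>pure_tensor\<close> reads only the directions below \<open>d\<close>,
      which are those that \<open>point\<close> records.\<close>
    have b: "pure_tensor d k (\<lambda>j. unit_vec k (F m j i)) = basis_vector (point F (m, i))" for m i
      unfolding basis_vector_def pure_tensor_def by (intro ext if_cong prod.cong) (simp_all add: point_nth)
    show ?thesis
      unfolding B_def b grid_list_def product_concat_map map_concat wedge_list_concat
      by (simp add: o_def)
  qed
  ultimately show ?thesis
    by (simp add: wedge_funpow_sum families_def flip: X_def)
qed

text \<open>Multiplier and vector stay unspecified: what matters later is that the power vanishes if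
  the Alon--Tarsi number does.\<close>

lemma cayley_wedge_funpow_one_alon_tarsi:
  assumes "odd d"
  obtains n \<Omega> where "(cayley_wedge d k ^^ N) ext_one = (\<lambda>S. of_int (n * alon_tarsi d k) * \<Omega> S)"
proof -
  \<comment> \<open>The common reference product for all families: the basis vectors of the cube in
    the order given by \<open>slice_point 0\<close>.\<close>
  define \<Omega> where "\<Omega> = wedge_list (map (\<lambda>p. ext_incl (basis_vector (slice_point 0 p))) grid_list)"
  \<comment> \<open>This sign compares the enumerations in the various directions and does not
    depend on the family.\<close>
  define c where "c = (\<Prod>l<d. sign (transition grid (slice_point 0) (slice_point l)))"
  define V where "V = {F \<in> families. inj_on (point F) grid}"
  \<comment> \<open>Grouping by the direction-0 permutations gives fibres that
    \<open>labelling\<close> maps bijectively onto all Latin hypercubes, so each fibre contributes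
    one Alon--Tarsi number.\<close>
  define first where "first F = (\<lambda>m\<in>{..<N}. F m (0::nat))" for F :: "nat \<Rightarrow> nat \<Rightarrow> nat \<Rightarrow> nat"
  let ?term = "\<lambda>F S. of_int (\<Prod>m<N. \<Prod>j<d. sign (F m j)) *
    wedge_list (map (\<lambda>p. ext_incl (basis_vector (point F p))) grid_list) S"
  have zero: "?term F S = 0" if "F \<in> families - V" for F S
  proof -
    have "\<not> inj_on (point F) grid"
      using that by (simp add: V_def)
    then obtain p q where "p \<in> grid" "q \<in> grid" "p \<noteq> q" "point F p = point F q"
      by (auto simp: inj_on_def)
    thus ?thesis
      using wedge_list_incl_eq_0[of p grid_list q "\<lambda>p. basis_vector (point F p)"]
      by (simp add: set_grid_list)
  qed
  have coeff: "?term F S = of_int c * \<Omega> S * of_int (latin_sign d k (labelling F))" if "F \<in> V" for F S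
  proof -
    let ?A = "transition grid (slice_point 0) (point F)"
    have F: "F \<in> families" "inj_on (point F) grid"
      using that by (auto simp: V_def)
    note bij = bij_betw_slice_point[OF labelling_in_latin_hypercubes[OF F] d_pos] bij_betw_point[OF F]
    have "map (\<lambda>p. ext_incl (basis_vector (point F p))) grid_list =
        map (\<lambda>p. ext_incl (basis_vector (slice_point 0 (?A p)))) grid_list"
      by (simp add: set_grid_list transition_apply[OF bij])
    hence "?term F S = of_int ((\<Prod>m<N. \<Prod>j<d. sign (F m j)) * sign ?A) * \<Omega> S"
      using wedge_list_incl_permutes[of ?A grid_list "\<lambda>p. basis_vector (slice_point 0 p)"]
        transition_permutes[OF bij]
      by (simp only: set_grid_list distinct_grid_list \<Omega>_def of_int_mult mult.assoc)
    thus ?thesis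
      unfolding sign_family[OF F \<open>odd d\<close>] c_def by (simp add: mult_ac)
  qed
  have fibre: "(\<Sum>F | F \<in> V \<and> first F = \<sigma>. of_int (latin_sign d k (labelling F))) =
      (of_int (alon_tarsi d k) :: complex)" if "\<sigma> \<in> first ` V" for \<sigma>
  proof -
    have "\<sigma> m permutes {..<k}" if "m < N" for m
      using that \<open>\<sigma> \<in> first ` V\<close> d_pos by (auto simp: first_def V_def families_permutes)
    \<comment> \<open>Being in the image of \<open>first\<close> makes \<sigma>
      \<open>undefined\<close> from \<open>N\<close> on, so equality with it is decided below
      \<open>N\<close>.\<close>
    moreover have "{F \<in> V. first F = \<sigma>} =
        {F \<in> families. inj_on (point F) grid \<and> (\<forall>m<N. F m 0 = \<sigma> m)}"
      using \<open>\<sigma> \<in> first ` V\<close> by (auto simp: V_def first_def fun_eq_iff restrict_def)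
    ultimately have "bij_betw labelling {F \<in> V. first F = \<sigma>} (latin_hypercubes d k)"
      using bij_betw_labelling[of \<sigma>] by simp
    from sum.reindex_bij_betw[OF this, of "\<lambda>C. of_int (latin_sign d k C) :: complex"] show ?thesis
      by (simp add: alon_tarsi_def)
  qed
  have fin: "finite V" "V \<subseteq> families"
    using finite_families by (auto simp: V_def)
  have "(cayley_wedge d k ^^ N) ext_one S =
      of_int (c * int (card (first ` V)) * alon_tarsi d k) * \<Omega> S" for S
  proof -
    have "(cayley_wedge d k ^^ N) ext_one S = (\<Sum>F\<in>families. ?term F S)"
      by (simp only: cayley_wedge_funpow_one)
    also have "\<dots> = (\<Sum>F\<in>V. ?term F S)"
      by (rule sum.mono_neutral_right) (use fin finite_families zero in auto)
    also have "\<dots> = of_int c * \<Omega> S * (\<Sum>F\<in>V. of_int (latin_sign d k (labelling F)))"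
      using coeff by (simp add: sum_distrib_left)
    also have "(\<Sum>F\<in>V. of_int (latin_sign d k (labelling F))) =
        (\<Sum>\<sigma>\<in>first ` V. \<Sum>F | F \<in> V \<and> first F = \<sigma>. (of_int (latin_sign d k (labelling F)) :: complex))"
      by (rule sum.group[symmetric]) (use fin in auto)
    also have "\<dots> = of_nat (card (first ` V)) * of_int (alon_tarsi d k)"
      using fibre by simp
    finally show ?thesis
      by (simp add: mult_ac)
  qed
  thus thesis
    using that by blast
qed

end

section \<open>The unit as an invariant of weight zero, and the conclusion\<close>

lemma ext_one_in_HWV: "ext_one \<in> HWV d k (\<lambda>j i. 0)"
proof -
  have "act d k g ext_one = ext_one" for g
  proof
    fix S
    \<comment> \<open>Only the empty set contributes, and its image is an empty product, which
      involves no matrix.\<close>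
    have "act d k g ext_one S = (\<Sum>T\<in>Pow (cube d k). if T = {} then ext_one S else 0)"
      unfolding act_def by (rule sum.cong) (auto simp: ext_one_def wedge_list_Nil)
    also have "\<dots> = ext_one S"
      using finite_lists_length_eq[of "{..<k}" d] by (simp add: cube_def conj_commute)
    finally show "act d k g ext_one S = ext_one S" .
  qed
  thus ?thesis
    by (auto simp: HWV_def weight_vector_def ext_space_def ext_one_def)
qed

lemma zero_in_HWV: "(\<lambda>S. 0) \<in> HWV d k \<mu>"
  by (simp add: HWV_def weight_vector_def ext_space_def act_def)

theorem proposition1p8:
  fixes d k :: nat and W :: "nat \<Rightarrow> nat list ext set"
  assumes "d \<ge> 3" and "odd d" and "even k"
    and W_def: "\<And>n. W n = HWV d k (\<lambda>j i. int n)"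
    and HLP: "\<And>n. 2 * n \<le> k ^ (d - 1) \<Longrightarrow>
      bij_betw (cayley_wedge d k ^^ (k ^ (d - 1) - 2 * n)) (W n) (W (k ^ (d - 1) - n))"
  shows "alon_tarsi d k \<noteq> 0"
proof
  assume AT: "alon_tarsi d k = 0"
  interpret hypercube d k
    using assms(1) by unfold_locales simp
  let ?L = "cayley_wedge d k ^^ N"
  obtain n \<Omega> where "?L ext_one = (\<lambda>S. of_int (n * alon_tarsi d k) * \<Omega> S)"
    using cayley_wedge_funpow_one_alon_tarsi[OF \<open>odd d\<close>] .
  hence "?L ext_one = (\<lambda>S. 0)"
    by (simp add: AT)
  moreover have "?L (\<lambda>S. 0) = (\<lambda>S. 0)"
  proof -
    have "(cayley_wedge d k ^^ n) (\<lambda>S. 0) = (\<lambda>S. 0)" for n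
      by (induction n) (simp_all add: cayley_wedge_def wedge_zero_right)
    thus ?thesis .
  qed
  \<comment> \<open>The case \<open>n = 0\<close>: both \<open>ext_one\<close> and zero lie in
    \<open>W 0\<close> and are sent to zero.\<close>
  moreover have "inj_on ?L (W 0)"
    using HLP[of 0] by (simp add: N_def bij_betw_def)
  ultimately have "ext_one = (\<lambda>S::nat list set. 0)"
    using ext_one_in_HWV[of d k] zero_in_HWV[of d k]
      inj_onD[of ?L "W 0" ext_one "\<lambda>S. 0"] by (simp add: W_def)
  hence "ext_one ({}::nat list set) = 0"
    by (rule fun_cong)
  thus False
    by (simp add: ext_one_def)
qed

end
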